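(* The class $\mathcal{TBP}_2$ of all finite paving TBRSCs of dimension at most $2$ is not finitely based; that is, there is no $m\ge1$ such that every simplicial complex not in $\mathcal{TBP}_2$ admits a restriction not in $\mathcal{TBP}_2$ with at most $m$ vertices.
   Context: A simplicial complex is a pair $(V,H)$ with $V$ finite nonempty, $H\subseteq 2^V$ containing all singletons and closed under subsets; its dimension $e$ is $\max\{|X|:X\in H\}-1$, and it is paving if $P_{\le e}(V)\subseteq H$, where $P_{\le k}(V)$ is the set of subsets of $V$ with at most $k$ elements. The restriction of $(V,H)$ to a nonempty $W\subseteq V$ is $(W,H\cap 2^W)$. A flat is a set $F\subseteq V$ with $X\cup\{p\}\in H$ for all $X\in H$, $X\subseteq F$, $p\in V\setminus F$. A complex is boolean representable (BRSC) if it admits a boolean matrix representation; equivalently every face $\{x_1,\dots,x_k\}$ admits a chain of flats $F_0\subset\cdots\subset F_k$ with $x_i\in F_i\setminus F_{i-1}$. The $k$-truncation of $(V,H)$ is $(V,H\cap P_{\le k}(V))$; a TBRSC is a complex equal to the $k$-truncation of some BRSC for some $k\ge1$. *)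

theory Defs
  imports Main "HOL-Library.Infinite_Typeclass"
begin

type_synonym 'a vcomplex = "'a set \<times> 'a set set"

definition simplicial_complex :: "'a vcomplex \<Rightarrow> bool" where
  "simplicial_complex K \<longleftrightarrow> (case K of (V, H) \<Rightarrow>
     finite V \<and> V \<noteq> {} \<and> H \<subseteq> Pow V \<and>
     (\<forall>v\<in>V. {v} \<in> H) \<and> (\<forall>X\<in>H. \<forall>Y. Y \<subseteq> X \<longrightarrow> Y \<in> H))"

text \<open>The subtraction does not truncate on simplicial complexes: they have a singleton face.\<close>

definition dimension :: "'a vcomplex \<Rightarrow> nat" where
  "dimension K = Max (card ` snd K) - 1"

definition subsets_upto :: "nat \<Rightarrow> 'a set \<Rightarrow> 'a set set" where
  "subsets_upto k V = {X. X \<subseteq> V \<and> card X \<le> k}"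

definition paving :: "'a vcomplex \<Rightarrow> bool" where
  "paving K \<longleftrightarrow> subsets_upto (dimension K) (fst K) \<subseteq> snd K"

definition restriction :: "'a vcomplex \<Rightarrow> 'a set \<Rightarrow> 'a vcomplex" where
  "restriction K W = (W, snd K \<inter> Pow W)"

definition truncation :: "nat \<Rightarrow> 'a vcomplex \<Rightarrow> 'a vcomplex" where
  "truncation k K = (fst K, snd K \<inter> subsets_upto k (fst K))"

definition flat :: "'a vcomplex \<Rightarrow> 'a set \<Rightarrow> bool" where
  "flat K F \<longleftrightarrow> F \<subseteq> fst K \<and>
     (\<forall>X\<in>snd K. X \<subseteq> F \<longrightarrow> (\<forall>p\<in>fst K - F. X \<union> {p} \<in> snd K))"

text \<open>
  A boolean matrix is a function \<open>M\<close> from row and column indices to \<open>bool\<close>. The lists \<open>ys\<close> and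
  \<open>xs\<close> select rows and columns together with an order on them, so that ranging over the lists
  amounts to permuting rows and columns independently. A square boolean matrix is nonsingular
  (over the superboolean semiring) iff such permutations bring it into lower unitriangular form.
\<close>

definition lower_unitriangular :: "('r \<Rightarrow> 'a \<Rightarrow> bool) \<Rightarrow> 'r list \<Rightarrow> 'a list \<Rightarrow> bool" where
  "lower_unitriangular M ys xs \<longleftrightarrow> length ys = length xs \<and>
     (\<forall>i<length xs. M (ys ! i) (xs ! i) \<and> (\<forall>j<length xs. i < j \<longrightarrow> \<not> M (ys ! i) (xs ! j)))"

definition nonsingular :: "('r \<Rightarrow> 'a \<Rightarrow> bool) \<Rightarrow> 'r set \<Rightarrow> 'a set \<Rightarrow> bool" where
  "nonsingular M Y X \<longleftrightarrow> (\<exists>ys xs. distinct ys \<and> set ys = Y \<and> distinct xs \<and> set xs = X \<and>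
     lower_unitriangular M ys xs)"

definition independent_columns :: "('r \<Rightarrow> 'a \<Rightarrow> bool) \<Rightarrow> 'r set \<Rightarrow> 'a set \<Rightarrow> bool" where
  "independent_columns M R X \<longleftrightarrow> (\<exists>Y\<subseteq>R. nonsingular M Y X)"

definition boolean_representation :: "('r \<Rightarrow> 'a \<Rightarrow> bool) \<Rightarrow> 'r set \<Rightarrow> 'a vcomplex \<Rightarrow> bool" where
  "boolean_representation M R K \<longleftrightarrow> finite R \<and>
     snd K = {X. X \<subseteq> fst K \<and> independent_columns M R X}"

text \<open>Matrices have finitely many rows, so indexing rows by natural numbers loses nothing.\<close>

definition BRSC :: "'a vcomplex \<Rightarrow> bool" where
  "BRSC K \<longleftrightarrow> simplicial_complex K \<and>
     (\<exists>(M :: nat \<Rightarrow> 'a \<Rightarrow> bool) R. boolean_representation M R K)"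

definition TBRSC :: "'a vcomplex \<Rightarrow> bool" where
  "TBRSC K \<longleftrightarrow> simplicial_complex K \<and> (\<exists>k\<ge>1. \<exists>L. BRSC L \<and> K = truncation k L)"

definition TBP :: "nat \<Rightarrow> 'a vcomplex set" where
  "TBP d = {K. TBRSC K \<and> paving K \<and> dimension K \<le> d}"

definition finitely_based :: "'a vcomplex set \<Rightarrow> bool" where
  "finitely_based C \<longleftrightarrow> (\<exists>m\<ge>1. \<forall>K. simplicial_complex K \<and> K \<notin> C \<longrightarrow>
     (\<exists>W. W \<noteq> {} \<and> W \<subseteq> fst K \<and> card W \<le> m \<and> restriction K W \<notin> C))"

lemma lower_unitriangular_Cons:
  "lower_unitriangular M (y # ys) (x # xs) \<longleftrightarrow>
     M y x \<and> (\<forall>z\<in>set xs. \<not> M y z) \<and> lower_unitriangular M ys xs"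
  unfolding lower_unitriangular_def
  by (auto simp: All_less_Suc2 all_set_conv_all_nth)

lemma flat_Int: "flat K F \<Longrightarrow> flat K G \<Longrightarrow> flat K (F \<inter> G)"
  unfolding flat_def by auto

lemma flat_zeros:
  assumes rep: "boolean_representation M R K" and y: "y \<in> R"
  shows "flat K {v \<in> fst K. \<not> M y v}"
  unfolding flat_def
proof (intro conjI ballI impI)
  fix X p assume X: "X \<in> snd K" "X \<subseteq> {v \<in> fst K. \<not> M y v}" and p: "p \<in> fst K - {v \<in> fst K. \<not> M y v}"
  from X(1) rep obtain ys xs where
    l: "set ys \<subseteq> R" "distinct ys" "distinct xs" "set xs = X" "lower_unitriangular M ys xs"
    unfolding boolean_representation_def independent_columns_def nonsingular_def by auto
  have "y \<notin> set ys"
  proof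
    assume "y \<in> set ys"
    then obtain i where i: "i < length ys" "ys ! i = y" by (auto simp: in_set_conv_nth)
    then have "M y (xs ! i)" "xs ! i \<in> X" using l unfolding lower_unitriangular_def by auto
    then show False using X(2) by auto
  qed
  moreover have "p \<notin> X" using X p by auto
  moreover have "lower_unitriangular M (y # ys) (p # xs)"
    using l X p by (auto simp: lower_unitriangular_Cons)
  ultimately have "nonsingular M (set (y # ys)) (X \<union> {p})"
    unfolding nonsingular_def using l by (intro exI[of _ "y # ys"] exI[of _ "p # xs"]) auto
  then have "independent_columns M R (X \<union> {p})"
    unfolding independent_columns_def using l y by (intro exI[of _ "set (y # ys)"]) auto
  then show "X \<union> {p} \<in> snd K"
    using rep X p unfolding boolean_representation_def by auto
qed auto

lemma flat_chain_of_unitriangular: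
  assumes rep: "boolean_representation M R K"
  shows "lower_unitriangular M ys xs \<Longrightarrow> set ys \<subseteq> R \<Longrightarrow> flat K G \<Longrightarrow> set xs \<subseteq> G \<Longrightarrow>
    \<exists>F. F (length xs) = G \<and> (\<forall>i\<le>length xs. flat K (F i)) \<and>
      (\<forall>i<length xs. F i \<subset> F (Suc i) \<and> rev xs ! i \<in> F (Suc i) - F i)"
proof (induction xs arbitrary: ys G)
  case Nil
  then show ?case by (intro exI[of _ "\<lambda>_. G"]) auto
next
  case (Cons x xs)
  then obtain y ys' where ys: "ys = y # ys'" by (cases ys) (auto simp: lower_unitriangular_def)
  let ?Z = "G \<inter> {v \<in> fst K. \<not> M y v}"
  have tri: "M y x" "\<forall>z\<in>set xs. \<not> M y z" "lower_unitriangular M ys' xs"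
    using Cons.prems(1) by (auto simp: ys lower_unitriangular_Cons)
  have fl: "flat K ?Z" using flat_Int[OF Cons.prems(3) flat_zeros[OF rep, of y]] Cons.prems(2) ys by auto
  have GV: "G \<subseteq> fst K" using Cons.prems(3) by (simp add: flat_def)
  have "set xs \<subseteq> ?Z" using Cons.prems GV tri by auto
  then obtain F where F: "F (length xs) = ?Z" "\<forall>i\<le>length xs. flat K (F i)"
    "\<forall>i<length xs. F i \<subset> F (Suc i) \<and> rev xs ! i \<in> F (Suc i) - F i"
    using Cons.IH[OF tri(3) _ fl] Cons.prems(2) ys by auto
  have step: "?Z \<subset> G \<and> x \<in> G - ?Z" using Cons.prems tri by auto
  let ?F = "\<lambda>i. if i \<le> length xs then F i else G"
  have chain: "?F i \<subset> ?F (Suc i) \<and> rev (x # xs) ! i \<in> ?F (Suc i) - ?F i" if "i < length (x # xs)" for i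
  proof (cases "i < length xs")
    case True
    then show ?thesis using F(3) by (simp add: nth_append)
  next
    case False
    then have "i = length xs" using that by simp
    then show ?thesis using F(1) step by (simp add: nth_append)
  qed
  have "?F (length (x # xs)) = G" by simp
  moreover have "\<forall>i\<le>length (x # xs). flat K (?F i)" using F(2) Cons.prems(3) by simp
  ultimately show ?case using chain by (intro exI[of _ ?F] conjI allI impI) (fact | simp only:)+
qed

lemma BRSC_iff_flat_chain:
  assumes sc: "simplicial_complex K"
  shows "BRSC K \<longleftrightarrow> (\<forall>X\<in>snd K. \<exists>xs F. distinct xs \<and> set xs = X \<and>
     (\<forall>i\<le>length xs. flat K (F i)) \<and>
     (\<forall>i<length xs. F i \<subset> F (Suc i) \<and> xs ! i \<in> F (Suc i) - F i))"
    (is "_ \<longleftrightarrow> ?chains")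
proof
  assume "BRSC K"
  then obtain M :: "nat \<Rightarrow> 'a \<Rightarrow> bool" and R where rep: "boolean_representation M R K"
    unfolding BRSC_def by auto
  show ?chains
  proof
    fix X assume X: "X \<in> snd K"
    then obtain ys xs where l: "set ys \<subseteq> R" "distinct xs" "set xs = X" "lower_unitriangular M ys xs"
      using rep unfolding boolean_representation_def independent_columns_def nonsingular_def by auto
    have "set xs \<subseteq> fst K" using X l rep unfolding boolean_representation_def by auto
    moreover have "flat K (fst K)" unfolding flat_def by auto
    ultimately obtain F where "\<forall>i\<le>length xs. flat K (F i)"
      "\<forall>i<length xs. F i \<subset> F (Suc i) \<and> rev xs ! i \<in> F (Suc i) - F i"
      using flat_chain_of_unitriangular[OF rep l(4) l(1), of "fst K"] by metis
    then show "\<exists>xs F. distinct xs \<and> set xs = X \<and> (\<forall>i\<le>length xs. flat K (F i)) \<and>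
        (\<forall>i<length xs. F i \<subset> F (Suc i) \<and> xs ! i \<in> F (Suc i) - F i)"
      using l by (intro exI[of _ "rev xs"] exI[of _ F]) simp
  qed
next
  assume chains: ?chains
  have fin: "finite {F. flat K F}"
    using sc by (auto simp: flat_def simplicial_complex_def intro: finite_subset[of _ "Pow (fst K)"])
  then obtain e where e: "bij_betw e {..<card {F. flat K F}} {F. flat K F}"
    using ex_bij_betw_nat_finite by (metis atLeast0LessThan)
  define R where "R = {..<card {F. flat K F}}"
  define M where "M r v \<longleftrightarrow> v \<notin> e r" for r :: nat and v :: 'a
  have eR: "flat K (e r)" if "r \<in> R" for r using e that unfolding R_def bij_betw_def by auto
  have surj: "\<exists>r\<in>R. e r = F" if "flat K F" for F
  proof -
    have "F \<in> e ` R" using e that unfolding R_def bij_betw_def by simp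
    then show ?thesis by blast
  qed
  have indep: "independent_columns M R X" if X: "X \<in> snd K" for X
  proof -
    obtain xs F where c: "distinct xs" "set xs = X" "\<forall>i\<le>length xs. flat K (F i)"
      "\<forall>i<length xs. F i \<subset> F (Suc i) \<and> xs ! i \<in> F (Suc i) - F i"
      using bspec[OF chains X] by (elim exE conjE) (rule that)
    have mono: "F i \<subseteq> F j" if "i \<le> j" "j \<le> length xs" for i j
      using that by (induction j rule: dec_induct) (use c(4) in \<open>auto dest!: Suc_le_lessD\<close>)
    have "\<forall>i. \<exists>r. i \<le> length xs \<longrightarrow> r \<in> R \<and> e r = F i" using surj c(3) by blast
    then obtain g where g: "\<And>i. i \<le> length xs \<Longrightarrow> g i \<in> R \<and> e (g i) = F i" by metis
    let ?n = "length xs"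
    let ?ys = "rev (map g [0..<?n])"
    have "inj_on g {0..<?n}"
    proof (rule linorder_inj_onI')
      fix i j assume ij: "i \<in> {0..<?n}" "j \<in> {0..<?n}" "i < j"
      then have "xs ! i \<in> F j" "xs ! i \<notin> F i" using c(4) mono[of "Suc i" j] by auto
      then show "g i \<noteq> g j" using g[of i] g[of j] ij by auto
    qed
    then have "distinct ?ys" by (simp add: distinct_map)
    moreover have "lower_unitriangular M ?ys (rev xs)"
      unfolding lower_unitriangular_def
    proof (intro conjI allI impI)
      fix i assume "i < length (rev xs)"
      then have i: "i < ?n" by simp
      show "M (?ys ! i) (rev xs ! i)"
        using i c(4) g[of "?n - Suc i"] by (auto simp: rev_nth M_def)
      fix j assume j: "j < length (rev xs)" "i < j"
      have "Suc (?n - Suc j) \<le> ?n - Suc i" "?n - Suc j < ?n" using j by auto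
      then have "xs ! (?n - Suc j) \<in> F (?n - Suc i)"
        using c(4) mono[of "Suc (?n - Suc j)" "?n - Suc i"] by auto
      then show "\<not> M (?ys ! i) (rev xs ! j)"
        using i j g[of "?n - Suc i"] by (auto simp: rev_nth M_def)
    qed simp
    ultimately have "nonsingular M (set ?ys) X"
      unfolding nonsingular_def using c(1,2) by (intro exI[of _ ?ys] exI[of _ "rev xs"]) auto
    moreover have "set ?ys \<subseteq> R" using g by auto
    ultimately show ?thesis unfolding independent_columns_def by blast
  qed
  have face: "lower_unitriangular M ys xs \<Longrightarrow> set ys \<subseteq> R \<Longrightarrow> set xs \<subseteq> fst K \<Longrightarrow> set xs \<in> snd K" for ys xs
  proof (induction xs arbitrary: ys)
    case Nil
    have "{} \<in> snd K" using sc unfolding simplicial_complex_def by (auto split: prod.splits)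
    then show ?case by simp
  next
    case (Cons x xs)
    then obtain y ys' where ys: "ys = y # ys'" by (cases ys) (auto simp: lower_unitriangular_def)
    have tri0: "M y x" "\<forall>z\<in>set xs. \<not> M y z" and tri1: "lower_unitriangular M ys' xs"
      using Cons.prems(1) unfolding ys lower_unitriangular_Cons by blast+
    have tri: "x \<notin> e y" "set xs \<subseteq> e y" using tri0 by (auto simp: M_def)
    have "set xs \<in> snd K" using Cons.IH[OF tri1] Cons.prems ys by auto
    then have "set xs \<union> {x} \<in> snd K"
      using eR[of y] Cons.prems tri ys unfolding flat_def by auto
    then show ?case by simp
  qed
  have "snd K = {X. X \<subseteq> fst K \<and> independent_columns M R X}"
  proof (intro equalityI subsetI)
    fix X assume "X \<in> snd K"
    moreover have "X \<subseteq> fst K" using \<open>X \<in> snd K\<close> sc unfolding simplicial_complex_def by (cases K) auto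
    ultimately show "X \<in> {X. X \<subseteq> fst K \<and> independent_columns M R X}" using indep by auto
  next
    fix X assume "X \<in> {X. X \<subseteq> fst K \<and> independent_columns M R X}"
    then show "X \<in> snd K" unfolding independent_columns_def nonsingular_def using face by auto
  qed
  then have "boolean_representation M R K" unfolding boolean_representation_def R_def by auto
  then show "BRSC K" using sc unfolding BRSC_def by blast
qed

end

theory Submission
  imports Defs
begin

text \<open>
  Let \<open>K\<close> have all pairs of vertices and no set of more than three vertices as faces, and call a
  set of vertices closed if it contains every triple that is not a face and that it meets in at
  least two points. Then \<open>K\<close> is in \<open>TBP 2\<close> iff no face \<open>{a, b, c}\<close> is bad, where bad means that
  each of its points lies in the closure of the other two.

  Take the vertices \<open>0, \<dots>, n - 1\<close> and let the triples that are not faces be the tight path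
  \<open>{i, i+1, i+2}\<close> together with \<open>{n-2, n-1, 0}\<close> and \<open>{n-2, n-1, 1}\<close>. Any two points of
  \<open>{0, 1, n-1}\<close> generate everything, so this face is bad. In a restriction, a pair of points is
  closed unless it lies in one of these triples, so a bad face consists of \<open>0\<close>, \<open>1\<close> and one of
  \<open>n-2\<close>, \<open>n-1\<close>. But once a vertex \<open>s\<close> with \<open>2 \<le> s < n - 2\<close> is missing, the closure of \<open>{0, 1}\<close>
  stays below \<open>s\<close>.
\<close>

section \<open>Paving truncated boolean representable complexes of dimension at most two\<close>

text \<open>This is the condition of \<open>flat\<close> imposed on two-point subsets only. If no
  face has four points, a proper flat contains no three-point face, whereas a closed set may. Such
  sets are what flats of a larger complex become after truncation.\<close>

definition pair_closed :: "'a vcomplex \<Rightarrow> 'a set \<Rightarrow> bool" where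
  "pair_closed K T \<longleftrightarrow> T \<subseteq> fst K \<and>
     (\<forall>a\<in>T. \<forall>b\<in>T. a \<noteq> b \<longrightarrow> (\<forall>p\<in>fst K - T. {a, b, p} \<in> snd K))"

text \<open>Distinctness is automatic: a row or column repeated at positions \<open>i < j\<close>
  would make the entry in row \<open>i\<close> and column \<open>j\<close> both true and
  false.\<close>

lemma independent_columns_iff:
  "independent_columns M R X \<longleftrightarrow>
     (\<exists>ys xs. set ys \<subseteq> R \<and> set xs = X \<and> lower_unitriangular M ys xs)"
proof -
  have "distinct ys \<and> distinct xs" if "lower_unitriangular M ys xs" for ys xs
    using that unfolding lower_unitriangular_def distinct_conv_nth
    by (metis linorder_neqE_nat)
  then have "nonsingular M Y X \<longleftrightarrow> (\<exists>ys xs. set ys = Y \<and> set xs = X \<and> lower_unitriangular M ys xs)"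
    for Y
    unfolding nonsingular_def by metis
  then show ?thesis
    unfolding independent_columns_def by auto
qed

text \<open>Deleting a column together with the row at its position keeps the triangular shape.
  Hence independence passes to subsets, as a simplicial complex requires.\<close>

lemma lower_unitriangular_subset:
  assumes "lower_unitriangular M ys xs" "Y \<subseteq> set xs"
  shows "\<exists>ys' xs'. set ys' \<subseteq> set ys \<and> set xs' = Y \<and> lower_unitriangular M ys' xs'"
  using assms
proof (induction xs arbitrary: ys Y)
  case Nil
  then show ?case by (intro exI[of _ "[]"]) (auto simp: lower_unitriangular_def)
next
  case (Cons x xs)
  then obtain y zs where ys: "ys = y # zs"
    by (cases ys) (auto simp: lower_unitriangular_def)
  have tri: "M y x" "\<forall>z\<in>set xs. \<not> M y z" "lower_unitriangular M zs xs"
    using Cons.prems(1) by (auto simp: ys lower_unitriangular_Cons)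
  have "Y - {x} \<subseteq> set xs" using Cons.prems(2) by auto
  from Cons.IH[OF tri(3) this]
  obtain ys' xs' where IH: "set ys' \<subseteq> set zs" "set xs' = Y - {x}" "lower_unitriangular M ys' xs'"
    by (elim exE conjE) (rule that)
  show ?case
  proof (cases "x \<in> Y")
    case True
    have "lower_unitriangular M (y # ys') (x # xs')"
      using tri IH \<open>Y - {x} \<subseteq> set xs\<close> by (auto simp: lower_unitriangular_Cons)
    moreover have "set (x # xs') = Y" "set (y # ys') \<subseteq> set ys" using IH True ys by auto
    ultimately show ?thesis by blast
  next
    case False
    then show ?thesis using IH ys by (intro exI[of _ ys'] exI[of _ xs']) auto
  qed
qed

text \<open>The closed sets serve as the rows of a matrix, each with its zeros at the members of its
  set. Up to three points, the complex so represented has the same faces as \<open>K\<close>;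
  truncation removes its larger faces.\<close>

lemma TBP_2_if_pair_closed:
  assumes sc: "simplicial_complex K" and le3: "\<And>X. X \<in> snd K \<Longrightarrow> card X \<le> 3"
    and pairs: "subsets_upto 2 (fst K) \<subseteq> snd K"
    and sep: "\<And>X. X \<in> snd K \<Longrightarrow> card X = 3 \<Longrightarrow>
      \<exists>x\<in>X. \<exists>T. pair_closed K T \<and> x \<notin> T \<and> X - {x} \<subseteq> T"
  shows "K \<in> TBP 2"
proof -
  have V: "finite (fst K)" "fst K \<noteq> {}" and H: "snd K \<subseteq> Pow (fst K)"
    using sc unfolding simplicial_complex_def by (auto split: prod.splits)
  have "finite {T. pair_closed K T}"
    using V by (auto simp: pair_closed_def intro: finite_subset[of _ "Pow (fst K)"])
  then obtain e where e: "bij_betw e {..<card {T. pair_closed K T}} {T. pair_closed K T}"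
    using ex_bij_betw_nat_finite by (metis atLeast0LessThan)
  define R where "R = {..<card {T. pair_closed K T}}"
  define M where "M r v \<longleftrightarrow> v \<notin> e r" for r :: nat and v :: 'a
  have eR: "pair_closed K (e r)" if "r \<in> R" for r
    using e that unfolding R_def bij_betw_def by auto
  have row: "\<exists>r\<in>R. e r = T" if "pair_closed K T" for T
  proof -
    have "T \<in> e ` R" using e that unfolding R_def bij_betw_def by simp
    then show ?thesis by blast
  qed
  \<comment> \<open>The empty set and the singletons are closed vacuously. Their rows make all
    points and all pairs independent.\<close>
  obtain r0 where r0: "r0 \<in> R" "e r0 = {}" using row[of "{}"] by (auto simp: pair_closed_def)
  have row1: "\<exists>r\<in>R. e r = {v}" if "v \<in> fst K" for v
    using row[of "{v}"] that by (simp add: pair_closed_def)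
  have lut0: "lower_unitriangular M [] []" by (simp add: lower_unitriangular_def)
  have lut1: "lower_unitriangular M [r0] [v]" for v
    using r0 lut0 by (simp add: lower_unitriangular_Cons M_def)
  have lut2: "\<exists>r\<in>R. lower_unitriangular M [r, r0] [a, b]" if "b \<in> fst K" "a \<noteq> b" for a b
    using row1[OF that(1)] that(2) lut1 by (auto simp: lower_unitriangular_Cons M_def)
  let ?L = "(fst K, {X. X \<subseteq> fst K \<and> independent_columns M R X})"
  have "independent_columns M R {v}" for v
    unfolding independent_columns_iff using lut1[of v] r0
    by (intro exI[of _ "[r0]"] exI[of _ "[v]"]) auto
  moreover have "independent_columns M R Y" if "independent_columns M R X" "Y \<subseteq> X" for X Y
    using that lower_unitriangular_subset unfolding independent_columns_iff
    by (metis (no_types, lifting) subset_trans)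
  ultimately have "simplicial_complex ?L"
    using V unfolding simplicial_complex_def by auto
  moreover have "boolean_representation M R ?L"
    unfolding boolean_representation_def R_def by simp
  ultimately have "BRSC ?L" unfolding BRSC_def by blast
  moreover have "K = truncation 3 ?L"
  proof -
    have "X \<in> snd K" if X: "X \<subseteq> fst K" "independent_columns M R X" "card X \<le> 3" for X
    proof (cases "card X \<le> 2")
      case True
      then show ?thesis using X pairs by (auto simp: subsets_upto_def)
    next
      case False
      then have "card X = 3" using X by simp
      obtain ys xs where l: "set ys \<subseteq> R" "set xs = X" "lower_unitriangular M ys xs"
        using X unfolding independent_columns_iff by blast
      have "length xs \<noteq> 0" using l False by auto
      then obtain x xs' y ys' where c: "xs = x # xs'" "ys = y # ys'"
        using l(3) by (cases xs; cases ys) (auto simp: lower_unitriangular_def)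
      \<comment> \<open>The first row is a closed set that contains the other two points of
        \<open>X\<close> but not \<open>x\<close>, so closedness makes \<open>X\<close> a
        face.\<close>
      have y: "x \<notin> e y" "set xs' \<subseteq> e y"
        using l(3) by (auto simp: c lower_unitriangular_Cons M_def)
      have "X - {x} \<subseteq> set xs'" "x \<in> X" using l c by auto
      moreover have "card (X - {x}) = 2" using \<open>card X = 3\<close> \<open>x \<in> X\<close> by simp
      then obtain a b where ab: "X - {x} = {a, b}" "a \<noteq> b" by (auto simp: card_2_iff)
      ultimately have "X = {a, b, x}" "a \<in> e y" "b \<in> e y" using y by auto
      moreover have "pair_closed K (e y)" using eR l c by simp
      ultimately show ?thesis using ab y X unfolding pair_closed_def by auto
    qed
    moreover have "independent_columns M R X" if X: "X \<in> snd K" for X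
    proof -
      have fX: "finite X" "X \<subseteq> fst K" using X H V finite_subset[of X "fst K"] by auto
      consider "card X = 0" | "card X = 1" | "card X = 2" | "card X = 3"
        using le3[OF X] by linarith
      then show ?thesis
      proof cases
        case 1
        then show ?thesis
          using fX lut0 unfolding independent_columns_iff by (intro exI[of _ "[]"]) auto
      next
        case 2
        then obtain v where "X = {v}" by (auto simp: card_1_singleton_iff)
        then show ?thesis using lut1[of v] r0 unfolding independent_columns_iff
          by (intro exI[of _ "[r0]"] exI[of _ "[v]"]) auto
      next
        case 3
        then obtain a b where ab: "X = {a, b}" "a \<noteq> b" by (auto simp: card_2_iff)
        then obtain r where "r \<in> R" "lower_unitriangular M [r, r0] [a, b]"
          using lut2[of b a] fX by auto
        then show ?thesis using ab r0 unfolding independent_columns_iff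
          by (intro exI[of _ "[r, r0]"] exI[of _ "[a, b]"]) auto
      next
        case 4
        then obtain x T where xT: "x \<in> X" "pair_closed K T" "x \<notin> T" "X - {x} \<subseteq> T"
          using sep[OF X] by blast
        then have "card (X - {x}) = 2" using 4 by simp
        then obtain a b where ab: "X - {x} = {a, b}" "a \<noteq> b" by (auto simp: card_2_iff)
        then obtain r where r: "r \<in> R" "lower_unitriangular M [r, r0] [a, b]"
          using lut2[of b a] fX by auto
        \<comment> \<open>The row of the separating set goes above the triangular pair: it is one at
          \<open>x\<close> and zero at \<open>a\<close> and \<open>b\<close>.\<close>
        obtain t where t: "t \<in> R" "e t = T" using row xT by blast
        have "lower_unitriangular M [t, r, r0] [x, a, b]"
          using r t xT ab by (subst lower_unitriangular_Cons) (auto simp: M_def)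
        moreover have "X = {x, a, b}" using ab xT by auto
        ultimately show ?thesis using r t r0 unfolding independent_columns_iff
          by (intro exI[of _ "[t, r, r0]"] exI[of _ "[x, a, b]"]) auto
      qed
    qed
    ultimately have "snd K = snd (truncation 3 ?L)"
      using H le3 unfolding truncation_def subsets_upto_def by auto
    then show ?thesis by (simp add: truncation_def prod_eq_iff)
  qed
  ultimately have "TBRSC K" unfolding TBRSC_def using sc by (meson one_le_numeral)
  moreover have dim: "dimension K \<le> 2"
  proof -
    have "finite (snd K)" using H V by (meson finite_Pow_iff finite_subset)
    moreover have "snd K \<noteq> {}" using pairs by (auto simp: subsets_upto_def)
    ultimately have "Max (card ` snd K) \<le> 3" using le3 by simp
    then show ?thesis unfolding dimension_def by simp
  qed
  moreover have "paving K"
    using dim pairs unfolding paving_def subsets_upto_def by auto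
  ultimately show ?thesis unfolding TBP_def by simp
qed

text \<open>In the complex \<open>L\<close> that \<open>K\<close> truncates, \<open>X\<close> has a
  chain of flats. Its member \<open>F 2\<close> contains the first two points of \<open>X\<close>
  and misses the third, and this flat of \<open>L\<close> is closed in \<open>K\<close>.\<close>

lemma pair_closed_if_TBP:
  assumes K: "K \<in> TBP d" and pairs: "subsets_upto 2 (fst K) \<subseteq> snd K"
    and X: "X \<in> snd K" "card X = 3"
  shows "\<exists>x\<in>X. \<exists>T. pair_closed K T \<and> x \<notin> T \<and> X - {x} \<subseteq> T"
proof -
  obtain k L where L: "BRSC L" "K = truncation k L"
    using K unfolding TBP_def TBRSC_def by blast
  have KL: "fst K = fst L" "snd K = snd L \<inter> subsets_upto k (fst L)"
    using L unfolding truncation_def by auto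
  then have "X \<in> snd L" "k \<ge> 3" using X by (auto simp: subsets_upto_def)
  moreover have "simplicial_complex L" using L(1) unfolding BRSC_def by blast
  ultimately obtain xs F where c: "distinct xs" "set xs = X"
    "\<forall>i\<le>length xs. flat L (F i)" "\<forall>i<length xs. F i \<subset> F (Suc i) \<and> xs ! i \<in> F (Suc i) - F i"
    using BRSC_iff_flat_chain[of L] L(1) by metis
  have len: "length xs = 3" using c X distinct_card by fastforce
  have F: "flat L (F 2)" "F 1 \<subset> F 2" using c(3,4) len by (auto simp: numeral_2_eq_2)
  have mem: "xs ! 0 \<in> F 1" "xs ! 1 \<in> F 2" "xs ! 2 \<notin> F 2"
    using c(4) len by (auto simp: numeral_2_eq_2)
  have "xs ! 2 \<in> X" using c(2) len by auto
  moreover have "X - {xs ! 2} \<subseteq> F 2"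
    using F mem by (auto simp: c(2)[symmetric] in_set_conv_nth len numeral_3_eq_3 less_Suc_eq)
      (auto simp: numeral_2_eq_2)
  moreover have "pair_closed K (F 2)"
    unfolding pair_closed_def
  proof (intro conjI ballI impI)
    show "F 2 \<subseteq> fst K" using F KL unfolding flat_def by simp
    fix a b p assume ab: "a \<in> F 2" "b \<in> F 2" "a \<noteq> b" and p: "p \<in> fst K - F 2"
    then have "{a, b} \<in> snd K" using pairs \<open>F 2 \<subseteq> fst K\<close> by (auto simp: subsets_upto_def)
    then have "{a, b} \<union> {p} \<in> snd L" using F(1) ab p KL unfolding flat_def by auto
    \<comment> \<open>The truncation level is at least three because the face \<open>X\<close>
      survives it, so \<open>{a, b, p}\<close> survives as well.\<close>
    moreover have "card {a, b, p} \<le> k"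
      using \<open>k \<ge> 3\<close> card_insert_le_m1[of 3 "{b, p}" a] by (auto simp: card_insert_if)
    ultimately show "{a, b, p} \<in> snd K"
      using ab p \<open>F 2 \<subseteq> fst K\<close> KL by (auto simp: subsets_upto_def insert_commute)
  qed
  ultimately show ?thesis using mem(3) by blast
qed

section \<open>A tight path with twisted ends\<close>

text \<open>A tight cycle would end with \<open>{n - 1, 0, 1}\<close>. The twist to
  \<open>{n - 2, n - 1, 1}\<close> leaves \<open>{0, 1, n - 1}\<close> as a face.\<close>

definition strip :: "nat \<Rightarrow> nat set set" where
  "strip n = {{i, i + 1, i + 2} | i. i + 2 < n} \<union> {{n - 2, n - 1, 0}, {n - 2, n - 1, 1}}"

text \<open>The map \<open>f\<close> carries the construction into an arbitrary infinite vertex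
  type, while the combinatorics stays with natural numbers.\<close>

definition strip_complex :: "(nat \<Rightarrow> 'a) \<Rightarrow> nat \<Rightarrow> 'a vcomplex" where
  "strip_complex f n =
     (f ` {..<n}, {X. X \<subseteq> f ` {..<n} \<and> card X \<le> 3 \<and> X \<notin> (`) f ` strip n})"

section \<open>Separating triples by closed sets\<close>

lemma strip_cases:
  assumes "S \<in> strip n"
  obtains i where "S = {i, i + 1, i + 2}" "i + 2 < n"
    | c where "c \<le> 1" "S = {n - 2, n - 1, c}"
  using assms unfolding strip_def by auto

lemma card_strip:
  assumes "S \<in> strip n" "n \<ge> 8"
  shows "card S = 3"
  using assms(1) by (cases rule: strip_cases) (use assms(2) in \<open>auto simp: card_insert_if\<close>)

text \<open>All other pairs lie in no triple and are therefore closed, which leaves few candidates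
  for a bad face.\<close>

lemma strip_edge:
  assumes "S \<in> strip n" "n \<ge> 8" "a \<in> S" "b \<in> S" "a < b"
  shows "b \<le> a + 2 \<or> a \<le> 1 \<and> b \<ge> n - 2"
  using assms(1) by (cases rule: strip_cases) (use assms(2-) in auto)

text \<open>If two points of \<open>X\<close> lie in no common triple, that pair separates the third
  point. Otherwise \<open>X\<close> is \<open>{0, 1, k}\<close> with \<open>k\<close> in the upper
  end, and the points of \<open>W\<close> below a missing vertex \<open>s\<close> separate
  \<open>k\<close>.\<close>

lemma strip_separated:
  assumes n: "n \<ge> 8" and W: "W \<subseteq> {..<n}" and gap: "{0, 1} \<subseteq> W \<Longrightarrow> \<not> {..<n - 2} \<subseteq> W"
    and X: "X \<subseteq> W" "card X = 3" "X \<notin> strip n"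
  shows "\<exists>x\<in>X. \<exists>T\<subseteq>W. x \<notin> T \<and> X - {x} \<subseteq> T \<and>
    (\<forall>a\<in>T. \<forall>b\<in>T. a \<noteq> b \<longrightarrow> (\<forall>p\<in>W - T. {a, b, p} \<notin> strip n))"
proof (cases "\<exists>x\<in>X. \<forall>S\<in>strip n. \<not> X - {x} \<subseteq> S")
  case True
  then obtain x where x: "x \<in> X" "\<forall>S\<in>strip n. \<not> X - {x} \<subseteq> S" by blast
  have "card (X - {x}) = 2" using X x by simp
  then obtain a b where ab: "X - {x} = {a, b}" "a \<noteq> b" by (auto simp: card_2_iff)
  have "{c, d, p} \<notin> strip n" if "c \<in> {a, b}" "d \<in> {a, b}" "c \<noteq> d" for c d p
  proof -
    have "X - {x} \<subseteq> {c, d, p}" using ab that by auto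
    then show ?thesis using x(2) by blast
  qed
  moreover have "{a, b} \<subseteq> W" "x \<notin> {a, b}" using ab X by auto
  ultimately show ?thesis
    using x(1) ab(1) by (intro bexI[of _ x] exI[of _ "{a, b}"] conjI) auto
next
  case False
  have "\<exists>i j k. X = {i, j, k} \<and> i < j \<and> j < k"
  proof -
    obtain a b c where abc: "X = {a, b, c}" "a \<noteq> b" "a \<noteq> c" "b \<noteq> c"
      using X(2) by (auto simp: card_3_iff)
    then show ?thesis by (metis insert_commute linorder_neqE_nat)
  qed
  then obtain i j k where ijk: "X = {i, j, k}" "i < j" "j < k" by blast
  have k: "k < n" using ijk X W by auto
  have edge: "b \<le> a + 2 \<or> a \<le> 1 \<and> b \<ge> n - 2"
    if "x \<in> X" "a \<in> X - {x}" "b \<in> X - {x}" "a < b" for a b x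
    using False that strip_edge[OF _ n] by blast
  have e: "j \<le> i + 2 \<or> i \<le> 1 \<and> j \<ge> n - 2" "k \<le> j + 2 \<or> j \<le> 1 \<and> k \<ge> n - 2"
      "k \<le> i + 2 \<or> i \<le> 1 \<and> k \<ge> n - 2"
    using edge[of k i j] edge[of i j k] edge[of j i k] ijk by auto
  have not_path: "\<not> (j = i + 1 \<and> k = i + 2)"
    using X(3) ijk k unfolding strip_def by auto
  have not_end: "\<not> (j = n - 2 \<and> k = n - 1 \<and> i \<le> 1)"
  proof
    assume *: "j = n - 2 \<and> k = n - 1 \<and> i \<le> 1"
    then have "X = {n - 2, n - 1, i}" "i = 0 \<or> i = 1" using ijk by auto
    then show False using X(3) unfolding strip_def by auto
  qed
  \<comment> \<open>If \<open>k \<le> i + 2\<close>, the points are consecutive, which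
    \<open>not_path\<close> excludes; so \<open>i \<le> 1\<close> and \<open>k \<ge> n - 2\<close>.
    By \<open>not_end\<close>, \<open>j\<close> is not in the upper end, so
    \<open>j \<le> 3\<close>. Then \<open>n \<ge> 8\<close> gives \<open>k > j + 2\<close>, which
    forces \<open>j \<le> 1\<close>.\<close>
  have "i = 0 \<and> j = 1 \<and> k \<ge> n - 2" using e not_path not_end ijk k n by auto
  then have ijk': "X = {0, 1, k}" "k \<ge> n - 2" using ijk by auto
  then have W01: "{0, 1} \<subseteq> W" using X by auto
  then obtain s where s: "s < n - 2" "s \<notin> W" using gap by auto
  have "s \<noteq> 0 \<and> s \<noteq> 1" using s W01 by (metis insert_subset)
  then have "2 \<le> s" by simp
  \<comment> \<open>A path triple with two points below \<open>s\<close> and one above would need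
    \<open>s\<close> as a fourth value among three consecutive numbers. In an end triple only
    \<open>c\<close> can lie below \<open>s\<close>.\<close>
  have "{a, b, p} \<notin> strip n"
    if "a \<in> W" "b \<in> W" "a < s" "b < s" "a \<noteq> b" "p \<in> W" "\<not> p < s" for a b p
  proof
    assume S: "{a, b, p} \<in> strip n"
    have "p > s" using that s by (metis linorder_neqE_nat)
    from S show False
    proof (cases rule: strip_cases)
      case (1 l)
      have "a \<in> {l, l + 1, l + 2}" "b \<in> {l, l + 1, l + 2}" "p \<in> {l, l + 1, l + 2}"
        using 1 by blast+
      then show False using that \<open>p > s\<close> by auto
    next
      case (2 c)
      have "a \<in> {n - 2, n - 1, c}" "b \<in> {n - 2, n - 1, c}" using 2 by blast+
      then show False using that s by auto
    qed
  qed
  then show ?thesis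
    using ijk' X s \<open>2 \<le> s\<close> by (intro bexI[of _ k] exI[of _ "{i \<in> W. i < s}"]) auto
qed

section \<open>The strip complex and its small restrictions\<close>

lemma simplicial_complex_restriction:
  assumes "simplicial_complex K" "W \<noteq> {}" "W \<subseteq> fst K"
  shows "simplicial_complex (restriction K W)"
  using assms unfolding simplicial_complex_def restriction_def
  by (auto split: prod.splits intro: finite_subset)

context
  fixes f :: "nat \<Rightarrow> 'a" and n :: nat
  assumes inj: "inj f" and n: "n \<ge> 8"
begin

lemma card_image_strip: "X \<in> (`) f ` strip n \<Longrightarrow> card X = 3"
  using card_strip[OF _ n] inj by (auto simp: card_image inj_on_subset)

lemma image_in_strip_iff: "f ` X \<in> (`) f ` strip n \<longleftrightarrow> X \<in> strip n"
  using inj by (auto simp: inj_image_eq_iff)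

lemma simplicial_complex_strip: "simplicial_complex (strip_complex f n)"
  unfolding simplicial_complex_def strip_complex_def prod.case
proof (intro conjI ballI allI impI)
  show "f ` {..<n} \<noteq> {}" using n by (auto simp: lessThan_empty_iff)
  show "{v} \<in> {X. X \<subseteq> f ` {..<n} \<and> card X \<le> 3 \<and> X \<notin> (`) f ` strip n}" if "v \<in> f ` {..<n}" for v
    using that card_image_strip[of "{v}"] by auto
  fix X Y assume X: "X \<in> {X. X \<subseteq> f ` {..<n} \<and> card X \<le> 3 \<and> X \<notin> (`) f ` strip n}" and Y: "Y \<subseteq> X"
  have fin: "finite X" using X finite_subset[of X "f ` {..<n}"] by blast
  \<comment> \<open>A triple already has the largest size of a face, so it cannot be a proper subset
    of one.\<close>
  have "Y = X" if "Y \<in> (`) f ` strip n"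
    using card_image_strip[OF that] X Y fin by (intro card_seteq) auto
  moreover have "card Y \<le> 3" using card_mono[OF fin Y] X by auto
  ultimately show "Y \<in> {X. X \<subseteq> f ` {..<n} \<and> card X \<le> 3 \<and> X \<notin> (`) f ` strip n}"
    using X Y by blast
qed auto

lemma pairs_strip: "subsets_upto 2 (fst (strip_complex f n)) \<subseteq> snd (strip_complex f n)"
  using card_image_strip unfolding subsets_upto_def strip_complex_def by fastforce

text \<open>A closed set with two points of the face \<open>{0, 1, n - 1}\<close> contains the
  third: \<open>0\<close> and \<open>1\<close> generate the path upwards, and either of them with
  \<open>n - 1\<close> first yields \<open>n - 2\<close> and then the path downwards.\<close>

lemma strip_complex_not_TBP: "strip_complex f n \<notin> TBP d"
proof
  assume "strip_complex f n \<in> TBP d"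
  define X where "X = {0, 1, n - 1}"
  have cX: "card X = 3" using n by (auto simp: X_def card_insert_if)
  have "X \<notin> strip n"
  proof
    assume "X \<in> strip n"
    then show False
    proof (cases rule: strip_cases)
      case (1 i)
      have "0 \<in> {i, i + 1, i + 2}" "n - 1 \<in> {i, i + 1, i + 2}"
        unfolding 1(1)[symmetric] by (simp_all add: X_def)
      then show False using n by auto
    next
      case (2 c)
      have "n - 2 \<in> X" using 2 by simp
      then show False using n by (auto simp: X_def)
    qed
  qed
  moreover have card_fX: "card (f ` X) = 3" using cX inj by (simp add: card_image inj_on_subset)
  moreover have "X \<subseteq> {..<n}" using n by (auto simp: X_def)
  ultimately have "f ` X \<in> snd (strip_complex f n)"
    by (simp add: strip_complex_def image_in_strip_iff image_mono)
  then obtain v T where vT: "v \<in> f ` X" "pair_closed (strip_complex f n) T" "v \<notin> T" "f ` X - {v} \<subseteq> T"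
    using pair_closed_if_TBP[OF \<open>strip_complex f n \<in> TBP d\<close> pairs_strip _ card_fX] by blast
  then obtain x where "x \<in> X" "v = f x" by blast
  then have x: "x \<in> X" "f x \<notin> T" "\<forall>y\<in>X. y \<noteq> x \<longrightarrow> f y \<in> T"
    using vT inj_eq[OF inj] by blast+
  have step: "f p \<in> T" if "{a, b, p} \<in> strip n" "f a \<in> T" "f b \<in> T" "a \<noteq> b" "p < n" for a b p
  proof (rule ccontr)
    assume "f p \<notin> T"
    then have "f p \<in> fst (strip_complex f n) - T" using that by (simp add: strip_complex_def)
    moreover have "f a \<noteq> f b" using that inj_eq[OF inj] by simp
    ultimately have "{f a, f b, f p} \<in> snd (strip_complex f n)"
      using vT(2) that(2,3) unfolding pair_closed_def by blast
    then show False using image_in_strip_iff[of "{a, b, p}"] that by (simp add: strip_complex_def)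
  qed
  have up: "f i \<in> T" if "f 0 \<in> T" "f 1 \<in> T" "i < n" for i
    using that(3)
  proof (induction i rule: less_induct)
    case (less i)
    show ?case
    proof (cases "i \<le> 1")
      case True
      then have "i = 0 \<or> i = 1" by auto
      then show ?thesis using that by auto
    next
      case False
      then have "{i - 2, i - 1, i} = {i - 2, (i - 2) + 1, (i - 2) + 2}" "(i - 2) + 2 < n"
        using less by auto
      then have "{i - 2, i - 1, i} \<in> strip n" unfolding strip_def by blast
      then show ?thesis using step[of "i - 2" "i - 1" i] less False by auto
    qed
  qed
  \<comment> \<open>Counting \<open>i\<close> from the upper end turns the descent into an ordinary
    induction.\<close>
  have down: "f (n - 1 - i) \<in> T" if "f (n - 2) \<in> T" "f (n - 1) \<in> T" "i < n" for i
    using that(3)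
  proof (induction i rule: less_induct)
    case (less i)
    show ?case
    proof (cases "i \<le> 1")
      case True
      then have "i = 0 \<or> i = 1" by auto
      then show ?thesis using that by (auto simp: numeral_2_eq_2)
    next
      case False
      let ?j = "n - 1 - i"
      have j: "n - 1 - (i - 1) = ?j + 1" "n - 1 - (i - 2) = ?j + 2" "?j + 2 < n"
        using False less.prems by auto
      then have "{?j, ?j + 1, ?j + 2} \<in> strip n" unfolding strip_def by blast
      then have "{?j + 1, ?j + 2, ?j} \<in> strip n" by (simp add: insert_commute)
      moreover have "f (?j + 1) \<in> T" "f (?j + 2) \<in> T"
        using less.IH[of "i - 1"] less.IH[of "i - 2"] j False less.prems by auto
      ultimately show ?thesis using step[of "?j + 1" "?j + 2" ?j] j by auto
    qed
  qed
  have low: "f i \<in> T" if "f c \<in> T" "f (n - 1) \<in> T" "c \<le> 1" "i < n" for c i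
  proof -
    have "{n - 2, n - 1, c} \<in> strip n" using that unfolding strip_def by (cases c) auto
    then have "{c, n - 1, n - 2} \<in> strip n" by (simp add: insert_commute)
    then have "f (n - 2) \<in> T" using step[of c "n - 1" "n - 2"] that n by auto
    then show ?thesis using down[of "n - 1 - i"] that by auto
  qed
  have "x < n" using x(1) n by (auto simp: X_def)
  consider "x = 0" | "x = 1" | "x = n - 1" using x(1) by (auto simp: X_def)
  then have "f x \<in> T"
  proof cases
    case 1
    then show ?thesis using x(3) n low[of 1 x] \<open>x < n\<close> by (auto simp: X_def)
  next
    case 2
    then show ?thesis using x(3) n low[of 0 x] \<open>x < n\<close> by (auto simp: X_def)
  next
    case 3
    then show ?thesis using x(3) n up[of x] \<open>x < n\<close> by (auto simp: X_def)
  qed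
  then show False using x(2) by simp
qed

text \<open>With fewer than \<open>n - 2\<close> vertices, \<open>W\<close> misses the image of some
  \<open>s < n - 2\<close>, so \<open>strip_separated\<close> applies to the preimage of
  \<open>W\<close>.\<close>

lemma restriction_strip_complex_TBP:
  assumes W: "W \<noteq> {}" "W \<subseteq> fst (strip_complex f n)" "card W + 3 \<le> n"
  shows "restriction (strip_complex f n) W \<in> TBP 2"
proof (rule TBP_2_if_pair_closed)
  let ?K = "restriction (strip_complex f n) W"
  have snd: "snd ?K = {X. X \<subseteq> W \<and> card X \<le> 3 \<and> X \<notin> (`) f ` strip n}" and [simp]: "fst ?K = W"
    using W(2) by (auto simp: restriction_def strip_complex_def)
  show "simplicial_complex ?K"
    using simplicial_complex_restriction[OF simplicial_complex_strip W(1,2)] .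
  show "card X \<le> 3" if "X \<in> snd ?K" for X using that snd by auto
  show "subsets_upto 2 (fst ?K) \<subseteq> snd ?K"
    using card_image_strip by (auto simp: snd subsets_upto_def)
  fix X assume X: "X \<in> snd ?K" "card X = 3"
  define U where "U = {i. i < n \<and> f i \<in> W}"
  have fU: "f ` U = W" using W(2) by (auto simp: U_def strip_complex_def)
  have U: "U \<subseteq> {..<n}" by (auto simp: U_def)
  have cU: "card U = card W" using fU inj by (metis card_image inj_on_subset subset_UNIV)
  obtain Y where Y: "Y \<subseteq> U" "X = f ` Y" using X(1) fU by (auto simp: snd subset_image_iff)
  have Y': "card Y = 3" "Y \<notin> strip n"
    using X Y inj image_in_strip_iff[of Y] by (auto simp: snd card_image inj_on_subset)
  have "\<not> {..<n - 2} \<subseteq> U"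
  proof
    assume "{..<n - 2} \<subseteq> U"
    then have "card {..<n - 2} \<le> card U" using U by (meson card_mono finite_lessThan finite_subset)
    then show False using cU W(3) by simp
  qed
  then obtain y T where yT: "y \<in> Y" "T \<subseteq> U" "y \<notin> T" "Y - {y} \<subseteq> T"
    "\<forall>a\<in>T. \<forall>b\<in>T. a \<noteq> b \<longrightarrow> (\<forall>p\<in>U - T. {a, b, p} \<notin> strip n)"
    using strip_separated[OF n U _ Y(1) Y'] by blast
  have "pair_closed ?K (f ` T)"
    unfolding pair_closed_def
  proof (intro conjI ballI impI)
    show "f ` T \<subseteq> fst ?K" using yT fU by auto
    fix a' b' p' assume "a' \<in> f ` T" "b' \<in> f ` T" "a' \<noteq> b'" "p' \<in> fst ?K - f ` T"
    then obtain a b p where abp: "a' = f a" "b' = f b" "p' = f p" "a \<in> T" "b \<in> T" "a \<noteq> b" "p \<in> U - T"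
      using fU by auto
    then have "f ` {a, b, p} \<notin> (`) f ` strip n" using yT(5) image_in_strip_iff by blast
    moreover have "card {a', b', p'} \<le> 3" by (auto simp: card_insert_if)
    moreover have "{a', b', p'} \<subseteq> W" using abp yT(2) fU by auto
    ultimately show "{a', b', p'} \<in> snd ?K" using abp by (simp add: snd)
  qed
  moreover have "f y \<notin> f ` T" "X - {f y} \<subseteq> f ` T" "f y \<in> X"
    using yT Y inj by (auto simp: inj_eq)
  ultimately show "\<exists>x\<in>X. \<exists>T. pair_closed ?K T \<and> x \<notin> T \<and> X - {x} \<subseteq> T" by blast
qed

end

theorem theorem6p23:
  shows "\<not> finitely_based (TBP 2 :: ('a :: infinite) vcomplex set)"
proof
  assume "finitely_based (TBP 2 :: 'a vcomplex set)"
  then obtain m where m: "\<forall>K :: 'a vcomplex. simplicial_complex K \<and> K \<notin> TBP 2 \<longrightarrow>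
     (\<exists>W. W \<noteq> {} \<and> W \<subseteq> fst K \<and> card W \<le> m \<and> restriction K W \<notin> TBP 2)"
    unfolding finitely_based_def by blast
  obtain f :: "nat \<Rightarrow> 'a" where f: "inj f"
    using infinite_countable_subset[OF infinite_UNIV] by blast
  \<comment> \<open>The summand \<open>8\<close> meets the lower bound on \<open>n\<close> and also
    leaves the margin of three that restrictions to \<open>m\<close> vertices require.\<close>
  have n: "m + 8 \<ge> 8" by simp
  obtain W where W: "W \<noteq> {}" "W \<subseteq> fst (strip_complex f (m + 8))" "card W \<le> m"
      "restriction (strip_complex f (m + 8)) W \<notin> TBP 2"
    using m[rule_format, OF conjI[OF simplicial_complex_strip[OF f n] strip_complex_not_TBP[OF f n]]]
    by (elim exE conjE) (rule that)
  then show False using restriction_strip_complex_TBP[OF f n W(1,2)] by simp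
qed

end
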